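(* Let $k$ be an algebraically closed field of characteristic zero, $n\ge 1$, $B=k[x_1,\dots,x_n]$, let $D$ be a locally nilpotent $k$-derivation of $B$ admitting a slice $s$ (i.e. $s\in B$ with $D(s)=1$), let $N\in\mathbb{Z}\setminus\{0\}$, and let $\alpha$ be the $\mathbb{G}_{\mathrm m}$-action on $\mathbb{A}^n=\operatorname{Spec}(B)$ associated with the semisimple derivation $\partial=NsD$. The following are equivalent: (1) The $\mathbb{G}_{\mathrm m}$-action $\alpha$ is linearizable. (2) There exists $\phi\in\operatorname{Aut}_k(B)$ such that $\phi D\phi^{-1}=\frac{\partial}{\partial x_n}$ and $\phi(s)=x_n$. (3) There exist $\phi\in\operatorname{Aut}_k(B)$ and $p\in k[x_1,\dots,x_{n-1}]$ such that $\phi D\phi^{-1}=\frac{\partial}{\partial x_n}$ and $\phi(s)=x_n+p$.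
   Context: A $k$-derivation $D$ of $B$ is locally nilpotent if for every $b\in B$ there is $m\ge 1$ with $D^m(b)=0$. If $D$ is locally nilpotent with slice $s$ and $A=\ker D$, then $B=A[s]$ is a polynomial ring in $s$ over $A$ (Slice Theorem). The derivation $\partial=NsD$ satisfies $\partial(as^m)=Nm\,as^m$ for $a\in A$, $m\ge 0$; the associated $\mathbb{G}_{\mathrm m}$-action $\alpha$ is given on $B$ by $\alpha_t(P(s))=P(t^Ns)$ for $P\in A[T]$, $t\in k^*$ (so $\alpha_t$ fixes $A$ pointwise). The action $\alpha$ is called linearizable if there exists $\phi\in\operatorname{Aut}_k(B)$ such that $\phi\partial\phi^{-1}$ is a diagonal linear derivation $\sum_i\lambda_i x_i\frac{\partial}{\partial x_i}$ with $\lambda_i\in k$ (i.e. $\alpha$ is conjugate to a linear action). *)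

theory Defs
  imports
    "HOL-Library.Poly_Mapping"
    "HOL-Computational_Algebra.Computational_Algebra"
begin

text \<open>
  Polynomials over a field \<open>'k\<close> in variables indexed by a finite type \<open>'n\<close>, so that
  \<open>B = k[x_1,...,x_n]\<close> with \<open>n = CARD('n) \<ge> 1\<close>: finitely supported functions from exponent
  vectors to coefficients, with the convolution product of \<open>Poly_Mapping\<close>.
  The last variable \<open>x_n\<close> is represented by a distinguished index \<open>l :: 'n\<close>, which is
  a parameter of the definitions that need it.
\<close>

type_synonym ('n, 'k) mpoly = "('n \<Rightarrow>\<^sub>0 nat) \<Rightarrow>\<^sub>0 'k"

definition Const :: "'k::field \<Rightarrow> ('n::finite, 'k) mpoly" where
  "Const c = Poly_Mapping.single 0 c"

definition Var :: "'n::finite \<Rightarrow> ('n, 'k::field) mpoly" where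
  "Var i = Poly_Mapping.single (Poly_Mapping.single i 1) 1"

text \<open>The exponent subtraction below truncates only where the factor \<open>of_nat 0\<close> kills the term.\<close>

definition partial :: "'n::finite \<Rightarrow> ('n, 'k::field) mpoly \<Rightarrow> ('n, 'k) mpoly" where
  "partial i f = (\<Sum>m\<in>Poly_Mapping.keys f.
     Poly_Mapping.single (m - Poly_Mapping.single i 1)
       (of_nat (Poly_Mapping.lookup m i) * Poly_Mapping.lookup f m))"

text \<open>The subring of polynomials not involving \<open>x_l\<close>, i.e. \<open>k[x_1,...,x_{n-1}]\<close>.\<close>

definition polys_without :: "'n::finite \<Rightarrow> ('n, 'k::field) mpoly set" where
  "polys_without l = {p. \<forall>m\<in>Poly_Mapping.keys p. Poly_Mapping.lookup m l = 0}"

definition k_algebra_aut :: "(('n::finite, 'k::field) mpoly \<Rightarrow> ('n, 'k) mpoly) \<Rightarrow> bool" where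
  "k_algebra_aut \<phi> \<longleftrightarrow> bij \<phi> \<and>
     (\<forall>f g. \<phi> (f + g) = \<phi> f + \<phi> g) \<and>
     (\<forall>f g. \<phi> (f * g) = \<phi> f * \<phi> g) \<and>
     (\<forall>c. \<phi> (Const c) = Const c)"

definition k_derivation :: "(('n::finite, 'k::field) mpoly \<Rightarrow> ('n, 'k) mpoly) \<Rightarrow> bool" where
  "k_derivation D \<longleftrightarrow>
     (\<forall>f g. D (f + g) = D f + D g) \<and>
     (\<forall>c f. D (Const c * f) = Const c * D f) \<and>
     (\<forall>f g. D (f * g) = f * D g + g * D f)"

definition locally_nilpotent :: "(('n::finite, 'k::field) mpoly \<Rightarrow> ('n, 'k) mpoly) \<Rightarrow> bool" where
  "locally_nilpotent D \<longleftrightarrow> (\<forall>b. \<exists>m\<ge>1. (D ^^ m) b = 0)"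

text \<open>
  For locally nilpotent \<open>D\<close> with slice \<open>s\<close> and \<open>A = ker D\<close>, every \<open>b\<close> in \<open>B = A[s]\<close> is \<open>P(s)\<close>
  for a unique \<open>P \<in> A[T]\<close> (Slice Theorem), and \<open>\<alpha>\<^sub>t (P(s)) = P(t\<^sup>N s)\<close> for \<open>t \<noteq> 0\<close>.
\<close>

definition slice_action ::
  "(('n::finite, 'k::field) mpoly \<Rightarrow> ('n, 'k) mpoly) \<Rightarrow> ('n, 'k) mpoly \<Rightarrow> int
    \<Rightarrow> 'k \<Rightarrow> ('n, 'k) mpoly \<Rightarrow> ('n, 'k) mpoly" where
  "slice_action D s N t b =
     poly (THE P. (\<forall>i. D (coeff P i) = 0) \<and> poly P s = b) (Const (t powi N) * s)"

text \<open>
  \<open>\<delta>\<close> is the derivation associated with the \<open>\<bbbG>\<^sub>m\<close>-action \<open>\<alpha>\<close>: the derivative at \<open>t = 1\<close> of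
  \<open>\<alpha>\<^sub>t b\<close>, which is a Laurent polynomial in \<open>t\<close> with coefficients in \<open>B\<close>.
  It is uniquely determined by \<open>\<alpha>\<close> when \<open>k\<close> is infinite; for \<open>\<alpha> = slice_action D s N\<close> it is
  \<open>a s\<^sup>m \<mapsto> N m a s\<^sup>m\<close> for \<open>a \<in> ker D\<close>, that is, \<open>N s D\<close>.
\<close>

definition associated_derivation ::
  "('k::field \<Rightarrow> ('n::finite, 'k) mpoly \<Rightarrow> ('n, 'k) mpoly)
    \<Rightarrow> (('n, 'k) mpoly \<Rightarrow> ('n, 'k) mpoly) \<Rightarrow> bool" where
  "associated_derivation \<alpha> \<delta> \<longleftrightarrow>
     (\<forall>b. \<exists>I c. finite I \<and>
        (\<forall>t. t \<noteq> 0 \<longrightarrow> \<alpha> t b = (\<Sum>i\<in>I. Const (t powi i) * c i)) \<and>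
        \<delta> b = (\<Sum>i\<in>I. Const (of_int i) * c i))"

definition diagonal_derivation ::
  "('n::finite \<Rightarrow> 'k::field) \<Rightarrow> ('n, 'k) mpoly \<Rightarrow> ('n, 'k) mpoly" where
  "diagonal_derivation w f = (\<Sum>i\<in>UNIV. Const (w i) * Var i * partial i f)"

definition linearizable ::
  "('k::field \<Rightarrow> ('n::finite, 'k) mpoly \<Rightarrow> ('n, 'k) mpoly) \<Rightarrow> bool" where
  "linearizable \<alpha> \<longleftrightarrow>
     (\<exists>\<delta>. associated_derivation \<alpha> \<delta> \<and>
       (\<exists>\<phi> w. k_algebra_aut \<phi> \<and> \<phi> \<circ> \<delta> \<circ> inv \<phi> = diagonal_derivation w))"

end

theory Submission
  imports Defs
begin

text \<open>
  The Slice Theorem writes every polynomial as \<open>\<Sum> a\<^sub>i s\<^sup>i\<close> with \<open>a\<^sub>i\<close> in \<open>ker D\<close>, uniquely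
  (\<open>slice_expansion_exists\<close>, \<open>slice_expansion_unique\<close>). The action multiplies the term of
  index \<open>i\<close> by \<open>t\<close> to the power \<open>N i\<close>, and a Laurent polynomial over an infinite field
  determines its coefficients, so the only derivation associated with the action is \<open>N s D\<close>
  (\<open>slice_action_associated\<close>, \<open>associated_derivation_unique\<close>).

  Everything then rests on one criterion: as soon as \<open>ker D\<close> is the ring of polynomials that do
  not involve some variable \<open>x\<^sub>i\<close>, the substitution \<open>x\<^sub>i \<mapsto> s\<close> is an automorphism, precisely
  because \<open>k[x\<^sub>1,...,x\<^sub>n] = (ker D)[s]\<close>, and it carries \<open>\<partial>/\<partial>x\<^sub>i\<close> to \<open>D\<close>
  (\<open>slice_straightening\<close>). After conjugation, and a swap of \<open>x\<^sub>i\<close> with the last variable, this is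
  the normal form (2) (\<open>normal_form_from_kernel\<close>). Under (3) the conjugate of \<open>D\<close> is
  \<open>\<partial>/\<partial>x\<^sub>n\<close> and the criterion applies at once.

  Under (1), let \<open>E\<close> and \<open>s\<close> be the conjugates of \<open>D\<close> and of the slice, so that
  \<open>N s E = \<Sum> w\<^sub>i x\<^sub>i \<partial>/\<partial>x\<^sub>i\<close>. Applied to \<open>x\<^sub>j\<close> this reads \<open>w\<^sub>j x\<^sub>j = N s E(x\<^sub>j)\<close>: every variable
  of nonzero weight is a multiple of the single polynomial \<open>s\<close>, which vanishes at the origin.
  Linear terms at the origin show that there is exactly one such variable \<open>x\<^sub>i\<close>
  (\<open>diagonal_slice_unique_weight\<close>). Hence \<open>ker E\<close>, the kernel of \<open>N s E = w\<^sub>i x\<^sub>i \<partial>/\<partial>x\<^sub>i\<close>,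
  consists of the polynomials without \<open>x\<^sub>i\<close>, and the criterion applies again.
\<close>

section \<open>Polynomials, substitution homomorphisms and partial derivatives\<close>

lemma Const_0 [simp]: "Const 0 = 0"
  and Const_1 [simp]: "Const 1 = 1"
  and Const_add: "Const (a + b) = Const a + Const b"
  and Const_mult: "Const (a * b) = Const a * Const b"
  and Const_of_nat: "Const (of_nat n) = of_nat n"
  by (simp_all add: Const_def single_add mult_single)

lemma Const_power: "Const (a ^ n) = Const a ^ n"
  by (induction n) (simp_all add: Const_mult)

lemma lookup_Const_mult [simp]:
  "Poly_Mapping.lookup (Const c * f) m = c * Poly_Mapping.lookup f m"
  unfolding Const_def mult_map_scale_conv_mult[symmetric]
  by (simp add: Poly_Mapping.map.rep_eq when_def)

lemma Const_mult_cancel: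
  assumes "c \<noteq> 0" "Const c * f = Const c * g"
  shows "f = g"
proof (rule poly_mapping_eqI)
  fix m
  from assms(2) have "c * Poly_Mapping.lookup f m = c * Poly_Mapping.lookup g m"
    by (metis lookup_Const_mult)
  with assms(1) show "Poly_Mapping.lookup f m = Poly_Mapping.lookup g m" by simp
qed

lemma mpoly_as_sum:
  fixes f :: "('n::finite, 'k::field) mpoly"
  shows "f = (\<Sum>m\<in>Poly_Mapping.keys f. Poly_Mapping.single m (Poly_Mapping.lookup f m))"
proof (rule poly_mapping_eqI)
  fix q
  have "(\<Sum>m\<in>Poly_Mapping.keys f. (Poly_Mapping.lookup f m when m = q))
        = (\<Sum>m\<in>Poly_Mapping.keys f. if m = q then Poly_Mapping.lookup f q else 0)"
    by (intro sum.cong) (auto simp: when_def)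
  also have "\<dots> = Poly_Mapping.lookup f q"
    by (simp add: in_keys_iff)
  finally show "Poly_Mapping.lookup f q = Poly_Mapping.lookup
     (\<Sum>m\<in>Poly_Mapping.keys f. Poly_Mapping.single m (Poly_Mapping.lookup f m)) q"
    by (simp add: lookup_sum lookup_single)
qed

lemma mpoly_induct_monomials [case_names monomial add]:
  fixes f :: "('n::finite, 'k::field) mpoly"
  assumes monomial: "\<And>m c. P (Poly_Mapping.single m c)"
    and add: "\<And>f g. P f \<Longrightarrow> P g \<Longrightarrow> P (f + g)"
  shows "P f"
proof -
  have "P 0" using monomial[of 0 0] by simp
  have "P (\<Sum>m\<in>M. Poly_Mapping.single m (Poly_Mapping.lookup f m))" if "finite M" for M
    using that by (induction M) (simp_all add: \<open>P 0\<close> assms)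
  then show ?thesis by (subst mpoly_as_sum) simp
qed

lemma mpoly_induct [case_names const var_mult add]:
  fixes f :: "('n::finite, 'k::field) mpoly"
  assumes const: "\<And>c. P (Const c)"
    and var_mult: "\<And>i f. P f \<Longrightarrow> P (Var i * f)"
    and add: "\<And>f g. P f \<Longrightarrow> P g \<Longrightarrow> P (f + g)"
  shows "P f"
proof (induction f rule: mpoly_induct_monomials)
  case (monomial m c)
  show ?case
  proof (induction "\<Sum>i\<in>UNIV. Poly_Mapping.lookup m i" arbitrary: m)
    case 0
    then have "m = 0" by (intro poly_mapping_eqI) simp
    then show ?case using const[of c] by (simp add: Const_def)
  next
    case (Suc d)
    then obtain i where i: "Poly_Mapping.lookup m i \<noteq> 0"
      by (metis (no_types, lifting) nat.distinct(1) sum.neutral)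
    define q where "q = m - Poly_Mapping.single i 1"
    have m: "m = Poly_Mapping.single i 1 + q"
      using i by (intro poly_mapping_eqI)
        (auto simp: q_def lookup_add lookup_minus lookup_single when_def)
    have "(\<Sum>j\<in>UNIV. Poly_Mapping.lookup m j)
        = (\<Sum>j\<in>UNIV. if i = j then 1 else 0) + (\<Sum>j\<in>UNIV. Poly_Mapping.lookup q j)"
      by (simp add: m lookup_add lookup_single when_def sum.distrib)
    then have "d = (\<Sum>j\<in>UNIV. Poly_Mapping.lookup q j)" using Suc.hyps(2) by simp
    from Suc.hyps(1)[OF this] have "P (Var i * Poly_Mapping.single q c)" by (rule var_mult)
    then show ?case by (simp add: Var_def mult_single m)
  qed
qed (rule add)

definition k_algebra_hom :: "(('n::finite, 'k::field) mpoly \<Rightarrow> ('n, 'k) mpoly) \<Rightarrow> bool" where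
  "k_algebra_hom \<phi> \<longleftrightarrow> (\<forall>f g. \<phi> (f + g) = \<phi> f + \<phi> g) \<and> (\<forall>f g. \<phi> (f * g) = \<phi> f * \<phi> g) \<and>
     (\<forall>c. \<phi> (Const c) = Const c)"

lemma k_algebra_aut_iff: "k_algebra_aut \<phi> \<longleftrightarrow> bij \<phi> \<and> k_algebra_hom \<phi>"
  by (auto simp: k_algebra_aut_def k_algebra_hom_def)

lemma
  assumes "k_algebra_hom \<phi>"
  shows hom_add: "\<phi> (f + g) = \<phi> f + \<phi> g"
    and hom_mult: "\<phi> (f * g) = \<phi> f * \<phi> g"
    and hom_Const: "\<phi> (Const c) = Const c"
    and hom_zero: "\<phi> 0 = 0"
    and hom_one: "\<phi> 1 = 1"
    and hom_power: "\<phi> (f ^ n) = \<phi> f ^ n"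
    and hom_diff: "\<phi> (f - g) = \<phi> f - \<phi> g"
    and hom_sum: "\<phi> (\<Sum>x\<in>X. h x) = (\<Sum>x\<in>X. \<phi> (h x))"
proof -
  have *: "\<phi> (f + g) = \<phi> f + \<phi> g" "\<phi> (f * g) = \<phi> f * \<phi> g" "\<phi> (Const c) = Const c" for f g c
    using assms by (auto simp: k_algebra_hom_def)
  have 0: "\<phi> 0 = 0" using *(3)[of 0] by simp
  have 1: "\<phi> 1 = 1" using *(3)[of 1] by simp
  show "\<phi> (f + g) = \<phi> f + \<phi> g" "\<phi> (f * g) = \<phi> f * \<phi> g" "\<phi> (Const c) = Const c" "\<phi> 0 = 0"
    "\<phi> 1 = 1" by (fact * 0 1)+
  show "\<phi> (f ^ n) = \<phi> f ^ n" by (induction n) (simp_all add: * 1)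
  show "\<phi> (f - g) = \<phi> f - \<phi> g" using *(1)[of "f - g" g] by simp
  show "\<phi> (\<Sum>x\<in>X. h x) = (\<Sum>x\<in>X. \<phi> (h x))"
    by (induction X rule: infinite_finite_induct) (simp_all add: * 0)
qed

lemma k_algebra_aut_comp:
  "k_algebra_aut \<phi> \<Longrightarrow> k_algebra_aut \<psi> \<Longrightarrow> k_algebra_aut (\<phi> \<circ> \<psi>)"
  by (auto simp: k_algebra_aut_def intro: bij_comp)

lemma k_algebra_aut_inv:
  assumes "k_algebra_aut \<phi>" shows "k_algebra_aut (inv \<phi>)"
proof -
  have b: "bij \<phi>" and h: "k_algebra_hom \<phi>" using assms by (auto simp: k_algebra_aut_iff)
  have eq: "inv \<phi> x = y" if "\<phi> y = x" for x y using b that by (metis bij_inv_eq_iff)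
  have s: "\<phi> (inv \<phi> x) = x" for x using b by (simp add: bij_is_surj surj_f_inv_f)
  show ?thesis unfolding k_algebra_aut_iff k_algebra_hom_def
    using bij_imp_bij_inv[OF b]
    by (auto intro!: eq simp: hom_add[OF h] hom_mult[OF h] hom_Const[OF h] s)
qed

definition subst :: "('n \<Rightarrow> ('n, 'k) mpoly) \<Rightarrow> ('n::finite, 'k::field) mpoly \<Rightarrow> ('n, 'k) mpoly" where
  "subst v f = (\<Sum>m\<in>Poly_Mapping.keys f.
     Const (Poly_Mapping.lookup f m) * (\<Prod>i\<in>UNIV. v i ^ Poly_Mapping.lookup m i))"

text \<open>A common index set for several polynomials makes the additivity of \<open>subst\<close> visible.\<close>

lemma subst_superset:
  assumes "finite M" "Poly_Mapping.keys f \<subseteq> M"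
  shows "subst v f
    = (\<Sum>m\<in>M. Const (Poly_Mapping.lookup f m) * (\<Prod>i\<in>UNIV. v i ^ Poly_Mapping.lookup m i))"
  unfolding subst_def using assms by (intro sum.mono_neutral_left) (auto simp: in_keys_iff)

lemma subst_add: "subst v (f + g) = subst v f + subst v g"
proof -
  define M where "M = Poly_Mapping.keys f \<union> Poly_Mapping.keys g"
  have "finite M" "Poly_Mapping.keys f \<subseteq> M" "Poly_Mapping.keys g \<subseteq> M"
    "Poly_Mapping.keys (f + g) \<subseteq> M"
    using keys_add[of f g] by (auto simp: M_def)
  then show ?thesis
    by (simp add: subst_superset[where M = M] lookup_add Const_add distrib_right sum.distrib)
qed

lemma subst_single:
  "subst v (Poly_Mapping.single m c) = Const c * (\<Prod>i\<in>UNIV. v i ^ Poly_Mapping.lookup m i)"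
  by (subst subst_superset[where M = "{m}"]) auto

lemma subst_mult: "subst v (f * g) = subst v f * subst v g"
proof (induction f rule: mpoly_induct_monomials)
  case (monomial m c)
  show ?case
  proof (induction g rule: mpoly_induct_monomials)
    case (monomial q d)
    show ?case
      by (simp add: mult_single subst_single lookup_add power_add prod.distrib Const_mult mult_ac)
  qed (simp add: distrib_left subst_add)
qed (simp add: distrib_right subst_add)

lemma subst_hom: "k_algebra_hom (subst v)"
  by (simp add: k_algebra_hom_def subst_add subst_mult) (simp add: Const_def subst_single)

lemma subst_Var [simp]: "subst v (Var i) = v i"
proof -
  have "v j ^ Poly_Mapping.lookup (Poly_Mapping.single i 1) j = (if i = j then v i else 1)" for j
    by (simp add: lookup_single)
  then have "subst v (Var i) = (\<Prod>j\<in>UNIV. if i = j then v i else 1)"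
    unfolding Var_def subst_single by simp
  then show ?thesis by simp
qed

lemma hom_ext:
  assumes "k_algebra_hom \<phi>" "k_algebra_hom \<psi>" "\<And>i. \<phi> (Var i) = \<psi> (Var i)"
  shows "\<phi> = \<psi>"
proof
  fix f show "\<phi> f = \<psi> f"
    using assms by (induction f rule: mpoly_induct) (simp_all add: hom_add hom_mult hom_Const)
qed

lemma subst_id: "subst Var f = f"
proof -
  have "subst Var = (id :: ('a, 'b) mpoly \<Rightarrow> ('a, 'b) mpoly)"
    by (rule hom_ext[OF subst_hom]) (simp_all add: k_algebra_hom_def)
  then show ?thesis by (simp add: fun_eq_iff)
qed

lemma subst_without:
  assumes "f \<in> polys_without i" "\<And>j. j \<noteq> i \<Longrightarrow> v j = Var j"
  shows "subst v f = f"
proof -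
  have "subst v f = subst Var f"
    unfolding subst_def
  proof (intro sum.cong arg_cong2[of _ _ _ _ "(*)"] prod.cong refl)
    fix m j assume "m \<in> Poly_Mapping.keys f"
    with assms show "v j ^ Poly_Mapping.lookup m j = Var j ^ Poly_Mapping.lookup m j"
      by (cases "j = i") (auto simp: polys_without_def)
  qed
  then show ?thesis by (simp add: subst_id)
qed

lemma lookup_partial:
  "Poly_Mapping.lookup (partial i f) m = of_nat (Suc (Poly_Mapping.lookup m i))
     * Poly_Mapping.lookup f (m + Poly_Mapping.single i 1)" (is "_ = _ * Poly_Mapping.lookup f ?q")
proof -
  have q: "q - Poly_Mapping.single i 1 = m \<longleftrightarrow> q = ?q" if "Poly_Mapping.lookup q i \<noteq> 0" for q
  proof
    assume "q - Poly_Mapping.single i 1 = m"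
    then show "q = ?q" using that
      by (intro poly_mapping_eqI) (auto simp: lookup_add lookup_minus lookup_single when_def)
  qed simp
  have "Poly_Mapping.lookup (partial i f) m = (\<Sum>q\<in>Poly_Mapping.keys f.
      of_nat (Poly_Mapping.lookup q i) * Poly_Mapping.lookup f q
        when q - Poly_Mapping.single i 1 = m)"
    by (simp add: partial_def lookup_sum lookup_single)
  also have "\<dots> = (\<Sum>q\<in>Poly_Mapping.keys f.
      if q = ?q then of_nat (Poly_Mapping.lookup ?q i) * Poly_Mapping.lookup f ?q else 0)"
  proof (intro sum.cong refl)
    fix q
    show "(of_nat (Poly_Mapping.lookup q i) * Poly_Mapping.lookup f q
        when q - Poly_Mapping.single i 1 = m)
      = (if q = ?q then of_nat (Poly_Mapping.lookup ?q i) * Poly_Mapping.lookup f ?q else 0)"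
      using q[of q] by (cases "Poly_Mapping.lookup q i = 0") (auto simp: when_def lookup_add)
  qed
  also have "\<dots> = of_nat (Suc (Poly_Mapping.lookup m i)) * Poly_Mapping.lookup f ?q"
    by (auto simp: in_keys_iff lookup_add)
  finally show ?thesis .
qed

lemma partial_add: "partial i (f + g) = partial i f + partial i g"
  by (rule poly_mapping_eqI) (simp add: lookup_partial lookup_add distrib_left)

lemma partial_single: "partial i (Poly_Mapping.single m c) =
    Poly_Mapping.single (m - Poly_Mapping.single i 1) (of_nat (Poly_Mapping.lookup m i) * c)"
  by (cases "c = 0") (auto simp: partial_def)

lemma partial_mult: "partial i (f * g) = f * partial i g + g * partial i f"
proof (induction f rule: mpoly_induct_monomials)
  case (monomial m c)
  show ?case
  proof (induction g rule: mpoly_induct_monomials)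
    case (monomial q d)
    have shift: "a + b - Poly_Mapping.single i 1 = a + (b - Poly_Mapping.single i 1)"
      if "Poly_Mapping.lookup b i \<noteq> 0" for a b :: "'a \<Rightarrow>\<^sub>0 nat"
      using that
      by (intro poly_mapping_eqI) (auto simp: lookup_add lookup_minus lookup_single when_def)
    have L: "Poly_Mapping.single (m + q - Poly_Mapping.single i 1)
               (of_nat (Poly_Mapping.lookup q i) * (c * d))
             = Poly_Mapping.single m c * partial i (Poly_Mapping.single q d)"
      using shift[of q m]
      by (cases "Poly_Mapping.lookup q i = 0") (simp_all add: partial_single mult_single mult_ac)
    have R: "Poly_Mapping.single (m + q - Poly_Mapping.single i 1)
               (of_nat (Poly_Mapping.lookup m i) * (c * d))
             = Poly_Mapping.single q d * partial i (Poly_Mapping.single m c)"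
      using shift[of m q]
      by (cases "Poly_Mapping.lookup m i = 0")
        (simp_all add: partial_single mult_single mult_ac add.commute)
    show ?case
      unfolding L[symmetric] R[symmetric]
      by (simp add: mult_single partial_single lookup_add single_add[symmetric] algebra_simps)
  qed (simp add: distrib_left distrib_right partial_add algebra_simps)
qed (simp add: distrib_left distrib_right partial_add algebra_simps)

lemma partial_Const [simp]: "partial i (Const c) = 0"
  by (simp add: Const_def partial_single)

lemma partial_derivation: "k_derivation (partial i)"
  by (simp add: k_derivation_def partial_add partial_mult)

lemma partial_Var: "partial i (Var j) = (if i = j then 1 else 0)"
  by (simp add: Var_def partial_single lookup_single when_def)

lemma partial_eq_0_iff:
  fixes f :: "('n::finite, 'k::field_char_0) mpoly"
  shows "partial i f = 0 \<longleftrightarrow> f \<in> polys_without i"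
proof
  assume 0: "partial i f = 0"
  show "f \<in> polys_without i"
    unfolding polys_without_def
  proof safe
    fix m assume m: "m \<in> Poly_Mapping.keys f"
    show "Poly_Mapping.lookup m i = 0"
    proof (rule ccontr)
      assume "Poly_Mapping.lookup m i \<noteq> 0"
      then have "m = (m - Poly_Mapping.single i 1) + Poly_Mapping.single i 1"
        by (intro poly_mapping_eqI) (auto simp: lookup_add lookup_minus lookup_single when_def)
      with m show False
        using lookup_partial[of i f "m - Poly_Mapping.single i 1"]
        by (auto simp: 0 in_keys_iff simp del: of_nat_Suc)
    qed
  qed
qed (auto simp: partial_def polys_without_def)

lemma lookup_Var_mult_partial:
  "Poly_Mapping.lookup (Var i * partial i f) m
     = of_nat (Poly_Mapping.lookup m i) * Poly_Mapping.lookup f m"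
proof (induction f rule: mpoly_induct_monomials)
  case (monomial q c)
  have "Poly_Mapping.single i 1 + (q - Poly_Mapping.single i 1) = q"
    if "Poly_Mapping.lookup q i \<noteq> 0"
    using that
    by (intro poly_mapping_eqI) (auto simp: lookup_add lookup_minus lookup_single when_def)
  then show ?case
    by (cases "Poly_Mapping.lookup q i = 0")
      (auto simp: partial_single Var_def mult_single lookup_single when_def)
qed (simp add: partial_add distrib_left lookup_add)

lemma lookup_diagonal:
  "Poly_Mapping.lookup (diagonal_derivation w f) m
     = (\<Sum>i\<in>UNIV. w i * of_nat (Poly_Mapping.lookup m i)) * Poly_Mapping.lookup f m"
  by (simp add: diagonal_derivation_def lookup_sum mult.assoc lookup_Var_mult_partial
      sum_distrib_right)

lemma diagonal_Var: "diagonal_derivation w (Var j) = Const (w j) * Var j"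
proof -
  have "diagonal_derivation w (Var j) = (\<Sum>i\<in>UNIV. if i = j then Const (w j) * Var j else 0)"
    unfolding diagonal_derivation_def by (intro sum.cong) (auto simp: partial_Var)
  then show ?thesis by simp
qed

lemma diagonal_single_weight:
  assumes "\<And>j. j \<noteq> i \<Longrightarrow> w j = 0"
  shows "diagonal_derivation w f = Const (w i) * Var i * partial i f"
proof -
  have "diagonal_derivation w f
      = (\<Sum>j\<in>UNIV. if j = i then Const (w i) * Var i * partial i f else 0)"
    unfolding diagonal_derivation_def using assms by (intro sum.cong) auto
  then show ?thesis by simp
qed

lemma lookup_mult_0:
  fixes f g :: "('n::finite, 'k::field) mpoly"
  shows "Poly_Mapping.lookup (f * g) 0 = Poly_Mapping.lookup f 0 * Poly_Mapping.lookup g 0"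
proof -
  have z: "a + b = 0 \<longleftrightarrow> a = 0 \<and> b = 0" for a b :: "'n \<Rightarrow>\<^sub>0 nat"
    by (auto simp: poly_mapping_eq_iff lookup_add fun_eq_iff)
  show ?thesis
  proof (induction f rule: mpoly_induct_monomials)
    case (monomial m c)
    show ?case
    proof (induction g rule: mpoly_induct_monomials)
      case (monomial q d)
      show ?case using z[of m q] by (auto simp: mult_single lookup_single when_def)
    qed (simp add: distrib_left lookup_add)
  qed (simp add: distrib_right lookup_add)
qed

section \<open>Derivations and the Slice Theorem\<close>

lemma
  fixes D :: "('n::finite, 'k::field) mpoly \<Rightarrow> ('n, 'k) mpoly"
  assumes "k_derivation D"
  shows der_add: "D (f + g) = D f + D g"
    and der_scale: "D (Const c * f) = Const c * D f"
    and der_mult: "D (f * g) = f * D g + g * D f"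
    and der_zero: "D 0 = 0"
    and der_Const: "D (Const c) = 0"
    and der_diff: "D (f - g) = D f - D g"
    and der_sum: "D (\<Sum>x\<in>X. h x) = (\<Sum>x\<in>X. D (h x))"
    and der_power: "D (f ^ Suc n) = of_nat (Suc n) * f ^ n * D f"
proof -
  have *: "D (f + g) = D f + D g" "D (Const c * f) = Const c * D f"
    "D (f * g) = f * D g + g * D f" for f g c
    using assms by (auto simp: k_derivation_def)
  have 0: "D 0 = 0" using *(2)[of 0 0] by simp
  have "D 1 = 0" using *(3)[of 1 1] by simp
  then show "D (Const c) = 0" using *(2)[of c 1] by simp
  show "D (f + g) = D f + D g" "D (Const c * f) = Const c * D f"
    "D (f * g) = f * D g + g * D f" "D 0 = 0" by (fact * 0)+
  show "D (f - g) = D f - D g" using *(1)[of "f - g" g] by simp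
  show "D (\<Sum>x\<in>X. h x) = (\<Sum>x\<in>X. D (h x))"
    by (induction X rule: infinite_finite_induct) (simp_all add: * 0)
  show "D (f ^ Suc n) = of_nat (Suc n) * f ^ n * D f"
    by (induction n) (simp_all add: *(3) algebra_simps)
qed

text \<open>Both \<open>D \<circ> \<sigma>\<close> and \<open>\<sigma> \<circ> E\<close> are derivations along \<open>\<sigma>\<close>, hence determined by their values
  on the variables.\<close>

lemma derivation_transport_ext:
  assumes "k_derivation D" "k_derivation E" "k_algebra_hom \<sigma>"
    and "\<And>i. D (\<sigma> (Var i)) = \<sigma> (E (Var i))"
  shows "D (\<sigma> f) = \<sigma> (E f)"
  using assms
  by (induction f rule: mpoly_induct)
    (simp_all add: hom_add hom_mult hom_Const hom_zero der_add der_mult der_Const)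

lemma conj_derivation:
  assumes "k_derivation D" "k_algebra_aut \<phi>"
  shows "k_derivation (\<phi> \<circ> D \<circ> inv \<phi>)"
proof -
  have h: "k_algebra_hom \<phi>" "k_algebra_hom (inv \<phi>)" and "bij \<phi>"
    using assms(2) k_algebra_aut_inv[of \<phi>] by (auto simp: k_algebra_aut_iff)
  then have "\<phi> (inv \<phi> x) = x" for x by (simp add: bij_is_surj surj_f_inv_f)
  then show ?thesis
    unfolding k_derivation_def o_def
    by (simp add: hom_add[OF h(1)] hom_add[OF h(2)] hom_mult[OF h(1)] hom_mult[OF h(2)]
        hom_Const[OF h(1)] hom_Const[OF h(2)] hom_zero[OF h(1)]
        der_add[OF assms(1)] der_mult[OF assms(1)] der_Const[OF assms(1)])
qed

lemma conj_locally_nilpotent: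
  assumes "locally_nilpotent D" "k_algebra_aut \<phi>"
  shows "locally_nilpotent (\<phi> \<circ> D \<circ> inv \<phi>)"
proof -
  have h: "k_algebra_hom \<phi>" and b: "bij \<phi>"
    using assms(2) by (auto simp: k_algebra_aut_iff)
  have "((\<phi> \<circ> D \<circ> inv \<phi>) ^^ m) f = \<phi> ((D ^^ m) (inv \<phi> f))" for m f
    using b by (induction m) (simp_all add: bij_is_inj bij_is_surj surj_f_inv_f)
  then show ?thesis
    using assms(1) by (metis locally_nilpotent_def hom_zero[OF h])
qed

lemma locally_nilpotent_induct [consumes 1, case_names zero step]:
  assumes "locally_nilpotent D"
    and "P 0" and "\<And>f. P (D f) \<Longrightarrow> P f"
  shows "P f"
proof -
  have "P f" if "(D ^^ m) f = 0" for m f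
    using that
    by (induction m arbitrary: f) (auto simp: funpow_Suc_right assms simp del: funpow.simps)
  then show ?thesis using assms(1) unfolding locally_nilpotent_def by blast
qed

text \<open>For a derivation with slice, \<open>s D\<close> multiplies \<open>a s\<^sup>i\<close> by \<open>i\<close>, so it has no negative
  eigenvalues. Applying \<open>D\<close> to the eigenvector equation lowers both the nilpotency order and the
  eigenvalue, which proves this without knowing that polynomials form an integral domain.\<close>

lemma no_negative_eigenvalue:
  fixes D :: "('n::finite, 'k::field_char_0) mpoly \<Rightarrow> ('n, 'k) mpoly"
  assumes D: "k_derivation D" "locally_nilpotent D" "D s = 1"
    and "of_nat (Suc m) * f + s * D f = 0"
  shows "f = 0"
  using D(2) assms(4)
proof (induction f arbitrary: m rule: locally_nilpotent_induct)
  case zero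
  show ?case by simp
next
  case (step f)
  have n: "D (of_nat (Suc m)) = 0"
    using der_Const[OF D(1), of "of_nat (Suc m)"] by (simp only: Const_of_nat)
  have "D (of_nat (Suc m) * f + s * D f) = 0"
    using step.prems by (simp only: der_zero[OF D(1)])
  then have "of_nat (Suc m) * D f + D f + s * D (D f) = 0"
    by (simp only: der_add[OF D(1)] der_mult[OF D(1)] n D(3)) (simp add: add_ac)
  then have "of_nat (Suc (Suc m)) * D f + s * D (D f) = 0"
    by (simp add: algebra_simps)
  then have "D f = 0" by (rule step.IH)
  with step.prems have "Const (of_nat (Suc m)) * f = Const (of_nat (Suc m)) * 0"
    by (simp only: Const_of_nat) simp
  then show ?case by (rule Const_mult_cancel[rotated]) (simp del: of_nat_Suc)
qed

text \<open>If \<open>s f = 0\<close>, then \<open>0 = D (s f) = f + s D f\<close>, so \<open>f\<close> would be an eigenvector of \<open>s D\<close>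
  for the eigenvalue \<open>-1\<close>.\<close>

lemma slice_cancel:
  fixes D :: "('n::finite, 'k::field_char_0) mpoly \<Rightarrow> ('n, 'k) mpoly"
  assumes D: "k_derivation D" "locally_nilpotent D" "D s = 1"
    and "s * f = 0"
  shows "f = 0"
proof (rule no_negative_eigenvalue[OF D, of 0])
  show "of_nat (Suc 0) * f + s * D f = 0"
    using der_mult[OF D(1), of s f] assms(4) D(3) by (simp add: der_zero[OF D(1)] add.commute)
qed

text \<open>Let \<open>P = a + T Q\<close> vanish at \<open>s\<close>, with coefficients in the kernel. Applying \<open>D\<close> to
  \<open>a + s Q(s) = 0\<close> removes \<open>a\<close> and makes \<open>Q(s)\<close> an eigenvector for \<open>-1\<close>, hence zero; the
  argument then descends to \<open>Q\<close>.\<close>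

lemma slice_expansion_unique:
  fixes D :: "('n::finite, 'k::field_char_0) mpoly \<Rightarrow> ('n, 'k) mpoly"
  assumes D: "k_derivation D" "locally_nilpotent D" "D s = 1"
    and "\<And>i. D (coeff P i) = 0" "\<And>i. D (coeff Q i) = 0" "poly P s = poly Q s"
  shows "P = Q"
proof -
  have "P = 0" if "\<forall>i. D (coeff P i) = 0" "poly P s = 0" for P
    using that
  proof (induction P)
    case (pCons a P)
    have "D (coeff (pCons a P) 0) = 0" and P: "\<forall>i. D (coeff P i) = 0"
      using pCons.prems(1) by (metis, metis coeff_pCons_Suc)
    then have "D (s * poly P s) = 0"
      using pCons.prems(2) der_add[OF D(1), of a "s * poly P s"] by (simp add: der_zero[OF D(1)])
    then have "of_nat (Suc 0) * poly P s + s * D (poly P s) = 0"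
      by (simp add: der_mult[OF D(1)] D(3) add.commute)
    then have "poly P s = 0" by (rule no_negative_eigenvalue[OF D])
    with pCons P show ?case by simp
  qed simp
  from this[of "P - Q"] show ?thesis using assms by (simp add: der_diff)
qed

text \<open>Induction on the nilpotency order: an expansion of \<open>D b\<close> is integrated term by term, and
  the result differs from \<open>b\<close> by an element of the kernel.\<close>

lemma slice_expansion_exists:
  fixes D :: "('n::finite, 'k::field_char_0) mpoly \<Rightarrow> ('n, 'k) mpoly"
  assumes D: "k_derivation D" "locally_nilpotent D" "D s = 1"
  obtains a n where "\<And>i. D (a i) = 0" "b = (\<Sum>i<n. a i * s ^ i)"
proof -
  have "\<exists>a n. (\<forall>i. D (a i) = 0) \<and> b = (\<Sum>i<(n::nat). a i * s ^ i)"
    using D(2)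
  proof (induction b rule: locally_nilpotent_induct)
    case zero
    show ?case by (rule exI[of _ "\<lambda>_. 0"], rule exI[of _ 0]) (simp add: der_zero[OF D(1)])
  next
    case (step b)
    then obtain a and n :: nat where a: "\<And>i. D (a i) = 0" and Db: "D b = (\<Sum>i<n. a i * s ^ i)"
      by blast
    define c where "c i = Const (1 / of_nat (Suc i)) * a i" for i
    have Dc: "D (c i) = 0" for i by (simp add: c_def der_scale[OF D(1)] a)
    have cancel: "of_nat (Suc i) * Const (1 / of_nat (Suc i)) = (1 :: ('n, 'k) mpoly)" for i
      by (simp only: Const_of_nat[symmetric] Const_mult[symmetric]) (simp del: of_nat_Suc)
    have "D (c i * s ^ Suc i) = a i * s ^ i" for i
    proof -
      have "D (c i * s ^ Suc i) = (of_nat (Suc i) * Const (1 / of_nat (Suc i))) * (a i * s ^ i)"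
        by (simp only: der_mult[OF D(1)] der_power[OF D(1)] Dc D(3)) (simp only: c_def mult_ac, simp)
      then show ?thesis by (simp only: cancel mult_1)
    qed
    then have "D (b - (\<Sum>i<n. c i * s ^ Suc i)) = 0"
      by (simp only: der_diff[OF D(1)] der_sum[OF D(1)] Db) simp
    then have "\<forall>i. D (case i of 0 \<Rightarrow> b - (\<Sum>i<n. c i * s ^ Suc i) | Suc i \<Rightarrow> c i) = 0"
      by (auto split: nat.split simp: Dc)
    moreover have "b = (\<Sum>i<Suc n.
        (case i of 0 \<Rightarrow> b - (\<Sum>i<n. c i * s ^ Suc i) | Suc i \<Rightarrow> c i) * s ^ i)"
      by (simp add: sum.lessThan_Suc_shift del: sum.lessThan_Suc)
    ultimately show ?case by blast
  qed
  then show ?thesis using that by blast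
qed

section \<open>The derivation associated with the slice action\<close>

lemma slice_action_eq:
  fixes D :: "('n::finite, 'k::field_char_0) mpoly \<Rightarrow> ('n, 'k) mpoly"
  assumes D: "k_derivation D" "locally_nilpotent D" "D s = 1"
    and a: "\<And>i. D (a i) = 0" and "t \<noteq> 0"
  shows "slice_action D s N t (\<Sum>i<n. a i * s ^ i)
    = (\<Sum>i<n. Const (t powi (N * int i)) * (a i * s ^ i))"
proof -
  define P where "P = (\<Sum>i<n. monom (a i) i)"
  have P: "D (coeff P i) = 0" for i
    by (auto simp: P_def coeff_sum der_sum[OF D(1)] a der_zero[OF D(1)] intro!: sum.neutral)
  have ev: "poly P x = (\<Sum>i<n. a i * x ^ i)" for x
    by (simp add: P_def poly_sum poly_monom)
  have "(THE Q. (\<forall>i. D (coeff Q i) = 0) \<and> poly Q s = (\<Sum>i<n. a i * s ^ i)) = P"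
    using P ev[of s] by (intro the_equality) (auto intro!: slice_expansion_unique[OF D])
  moreover have "Const (t powi (N * int i)) = (Const (t powi N) :: ('n, 'k) mpoly) ^ i" for i
    by (simp add: power_int_mult Const_power)
  ultimately show ?thesis
    by (simp add: slice_action_def ev power_mult_distrib mult_ac)
qed

text \<open>Multiplication by a power of \<open>t\<close> clears the negative exponents and leaves an ordinary
  polynomial with infinitely many roots.\<close>

lemma laurent_zero:
  fixes c :: "int \<Rightarrow> 'k::field_char_0"
  assumes "finite I" and 0: "\<And>t. t \<noteq> 0 \<Longrightarrow> (\<Sum>i\<in>I. t powi i * c i) = 0" and "j \<in> I"
  shows "c j = 0"
proof -
  define M where "M = Min I"
  have M: "M \<le> i" if "i \<in> I" for i using assms(1) that by (simp add: M_def)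
  define p where "p = (\<Sum>i\<in>I. monom (c i) (nat (i - M)))"
  have "poly p t = 0" if "t \<noteq> 0" for t
  proof -
    have "poly p t = (\<Sum>i\<in>I. t powi (- M) * (t powi i * c i))"
      unfolding p_def poly_sum poly_monom
    proof (intro sum.cong refl)
      fix i assume "i \<in> I"
      then have "t ^ nat (i - M) = t powi (i - M)" using M by (simp add: power_int_def)
      also have "\<dots> = t powi (- M) * t powi i"
        using that by (simp add: power_int_diff power_int_minus field_simps)
      finally show "c i * t ^ nat (i - M) = t powi (- M) * (t powi i * c i)" by simp
    qed
    also have "\<dots> = 0" using 0[OF that] by (simp add: sum_distrib_left[symmetric])
    finally show ?thesis .
  qed
  then have "- {0} \<subseteq> {t. poly p t = 0}" by auto
  moreover have "infinite (- {0 :: 'k})" using infinite_UNIV_char_0 by (simp add: finite_compl)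
  ultimately have "p = 0" using poly_roots_finite finite_subset by blast
  then have "0 = coeff p (nat (j - M))" by simp
  also have "\<dots> = (\<Sum>i\<in>I. if i = j then c j else 0)"
    unfolding p_def coeff_sum
    using M \<open>j \<in> I\<close> by (intro sum.cong) (auto simp: eq_nat_nat_iff)
  also have "\<dots> = c j" using assms by simp
  finally show ?thesis by simp
qed

lemma laurent_derivative_unique:
  fixes c d :: "int \<Rightarrow> ('n::finite, 'k::field_char_0) mpoly"
  assumes fin: "finite I" "finite J"
    and eq: "\<And>t. t \<noteq> 0 \<Longrightarrow>
      (\<Sum>i\<in>I. Const (t powi i) * c i) = (\<Sum>i\<in>J. Const (t powi i) * d i)"
  shows "(\<Sum>i\<in>I. Const (of_int i) * c i) = (\<Sum>i\<in>J. Const (of_int i) * d i)"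
proof (rule poly_mapping_eqI)
  fix m
  \<comment> \<open>The two families are padded with zeros, since \<open>I\<close> and \<open>J\<close> need not agree.\<close>
  define u where "u i = (if i \<in> I then Poly_Mapping.lookup (c i) m else 0)
    - (if i \<in> J then Poly_Mapping.lookup (d i) m else 0)" for i
  have lookup_diff: "(\<Sum>i\<in>I \<union> J. g i * u i)
      = Poly_Mapping.lookup (\<Sum>i\<in>I. Const (g i) * c i) m
        - Poly_Mapping.lookup (\<Sum>i\<in>J. Const (g i) * d i) m" for g
  proof -
    have "(\<Sum>i\<in>I \<union> J. g i * u i)
        = (\<Sum>i\<in>I \<union> J. if i \<in> I then g i * Poly_Mapping.lookup (c i) m else 0)
        - (\<Sum>i\<in>I \<union> J. if i \<in> J then g i * Poly_Mapping.lookup (d i) m else 0)"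
      unfolding sum_subtractf[symmetric] by (intro sum.cong) (auto simp: u_def algebra_simps)
    also have "\<dots> = (\<Sum>i\<in>I. g i * Poly_Mapping.lookup (c i) m)
        - (\<Sum>i\<in>J. g i * Poly_Mapping.lookup (d i) m)"
      using fin by (simp add: sum.inter_restrict[symmetric] Int_absorb1 Int_absorb2)
    finally show ?thesis by (simp add: lookup_sum)
  qed
  have "u i = 0" if "i \<in> I \<union> J" for i
  proof (rule laurent_zero[OF _ _ that])
    show "finite (I \<union> J)" using fin by simp
    show "(\<Sum>i\<in>I \<union> J. t powi i * u i) = 0" if "t \<noteq> 0" for t
      by (simp add: lookup_diff eq[OF that])
  qed
  then have "(\<Sum>i\<in>I \<union> J. of_int i * u i) = 0" by simp
  then show "Poly_Mapping.lookup (\<Sum>i\<in>I. Const (of_int i) * c i) m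
      = Poly_Mapping.lookup (\<Sum>i\<in>J. Const (of_int i) * d i) m"
    by (simp add: lookup_diff)
qed

lemma associated_derivation_unique:
  fixes \<alpha> :: "'k::field_char_0 \<Rightarrow> ('n::finite, 'k) mpoly \<Rightarrow> ('n, 'k) mpoly"
  assumes "associated_derivation \<alpha> \<delta>" "associated_derivation \<alpha> \<epsilon>"
  shows "\<delta> = \<epsilon>"
proof
  fix b
  from assms(1)[unfolded associated_derivation_def, THEN spec, of b] obtain I c where I: "finite I"
    "\<And>t. t \<noteq> 0 \<Longrightarrow> \<alpha> t b = (\<Sum>i\<in>I. Const (t powi i) * c i)"
    "\<delta> b = (\<Sum>i\<in>I. Const (of_int i) * c i)"
    by blast
  from assms(2)[unfolded associated_derivation_def, THEN spec, of b] obtain J d where J: "finite J"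
    "\<And>t. t \<noteq> 0 \<Longrightarrow> \<alpha> t b = (\<Sum>i\<in>J. Const (t powi i) * d i)"
    "\<epsilon> b = (\<Sum>i\<in>J. Const (of_int i) * d i)"
    by blast
  show "\<delta> b = \<epsilon> b"
    unfolding I(3) J(3)
  proof (rule laurent_derivative_unique[OF I(1) J(1)])
    show "(\<Sum>i\<in>I. Const (t powi i) * c i) = (\<Sum>i\<in>J. Const (t powi i) * d i)" if "t \<noteq> 0" for t
      using I(2)[OF that] J(2)[OF that] by simp
  qed
qed

lemma slice_action_associated:
  fixes D :: "('n::finite, 'k::field_char_0) mpoly \<Rightarrow> ('n, 'k) mpoly"
  assumes D: "k_derivation D" "locally_nilpotent D" "D s = 1" and "N \<noteq> 0"
  shows "associated_derivation (slice_action D s N) (\<lambda>b. Const (of_int N) * (s * D b))"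
  unfolding associated_derivation_def
proof
  fix b
  obtain a n where a: "\<And>i. D (a i) = 0" and b: "b = (\<Sum>i<n. a i * s ^ i)"
    using slice_expansion_exists[OF D] by metis
  define I where "I = (\<lambda>i. N * int i) ` {..<n}"
  \<comment> \<open>Reindexing by the weight \<open>j = N i\<close>; the sign of \<open>N\<close> cancels in \<open>j div N\<close>.\<close>
  define c where "c j = a (nat (j div N)) * s ^ nat (j div N)" for j
  have c: "c (N * int i) = a i * s ^ i" for i using \<open>N \<noteq> 0\<close> by (simp add: c_def)
  have inj: "inj_on (\<lambda>i. N * int i) {..<n}" using \<open>N \<noteq> 0\<close> by (auto intro!: inj_onI)
  have "slice_action D s N t b = (\<Sum>i\<in>I. Const (t powi i) * c i)" if "t \<noteq> 0" for t
    unfolding b slice_action_eq[OF D a that] I_def sum.reindex[OF inj] by (simp add: c)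
  moreover have "Const (of_int N) * (s * D b) = (\<Sum>i\<in>I. Const (of_int i) * c i)"
  proof -
    have "s * D (a i * s ^ i) = of_nat i * (a i * s ^ i)" for i
      by (cases i)
        (simp_all add: der_mult[OF D(1)] der_power[OF D(1)] a D(3) mult_ac
          del: power_Suc of_nat_Suc, simp_all add: mult_ac)
    then have "Const (of_int N) * (s * D b) = (\<Sum>i<n. Const (of_int (N * int i)) * (a i * s ^ i))"
      by (simp add: b der_sum[OF D(1)] sum_distrib_left Const_mult Const_of_nat mult_ac)
    also have "\<dots> = (\<Sum>i\<in>I. Const (of_int i) * c i)"
      unfolding I_def sum.reindex[OF inj] by (simp add: c)
    finally show ?thesis .
  qed
  moreover have "finite I" by (simp add: I_def)
  ultimately show "\<exists>I c. finite I \<and>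
      (\<forall>t. t \<noteq> 0 \<longrightarrow> slice_action D s N t b = (\<Sum>i\<in>I. Const (t powi i) * c i)) \<and>
      Const (of_int N) * (s * D b) = (\<Sum>i\<in>I. Const (of_int i) * c i)" by blast
qed

section \<open>Straightening a slice\<close>

text \<open>The substitution \<open>\<sigma>\<close> of \<open>s\<close> for \<open>x\<^sub>i\<close> fixes \<open>ker D\<close> pointwise, so it is surjective by the
  Slice Theorem. If \<open>\<sigma> f = 0\<close>, then \<open>\<sigma> (\<partial>f/\<partial>x\<^sub>i) = D (\<sigma> f) = 0\<close>; by induction on the degree in
  \<open>x\<^sub>i\<close> the derivative vanishes, so \<open>f\<close> does not involve \<open>x\<^sub>i\<close> and \<open>f = \<sigma> f = 0\<close>.\<close>

lemma slice_straightening: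
  fixes D :: "('n::finite, 'k::field_char_0) mpoly \<Rightarrow> ('n, 'k) mpoly"
  assumes D: "k_derivation D" "locally_nilpotent D" "D s = 1"
    and ker: "\<And>f. D f = 0 \<longleftrightarrow> f \<in> polys_without i"
  obtains \<sigma> where "k_algebra_aut \<sigma>" "\<And>f. D (\<sigma> f) = \<sigma> (partial i f)" "\<sigma> (Var i) = s"
proof
  define \<sigma> where "\<sigma> = subst (\<lambda>j. if j = i then s else Var j)"
  have h: "k_algebra_hom \<sigma>" unfolding \<sigma>_def by (rule subst_hom)
  have V: "\<sigma> (Var j) = (if j = i then s else Var j)" for j by (simp add: \<sigma>_def)
  have fixed: "\<sigma> f = f" if "f \<in> polys_without i" for f
    unfolding \<sigma>_def using that by (rule subst_without) simp
  have DV: "D (Var j) = 0" if "j \<noteq> i" for j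
    using that by (simp add: ker partial_eq_0_iff[symmetric] partial_Var)
  show comm: "D (\<sigma> f) = \<sigma> (partial i f)" for f
    by (rule derivation_transport_ext[OF D(1) partial_derivation h])
      (auto simp: V DV D(3) partial_Var hom_one[OF h] hom_zero[OF h])
  have inj0: "f = 0" if "\<sigma> f = 0" "\<forall>m\<in>Poly_Mapping.keys f. Poly_Mapping.lookup m i < d" for f d
    using that
  proof (induction d arbitrary: f)
    case 0
    then have "Poly_Mapping.keys f = {}" by auto
    then show ?case by (intro poly_mapping_eqI) (metis empty_iff in_keys_iff lookup_zero)
  next
    case (Suc d)
    have "partial i f = 0"
    proof (rule Suc.IH)
      show "\<sigma> (partial i f) = 0" using Suc.prems(1) comm[of f] der_zero[OF D(1)] by simp
      show "\<forall>m\<in>Poly_Mapping.keys (partial i f). Poly_Mapping.lookup m i < d"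
      proof
        fix m assume "m \<in> Poly_Mapping.keys (partial i f)"
        then have "m + Poly_Mapping.single i 1 \<in> Poly_Mapping.keys f"
          by (auto simp: in_keys_iff lookup_partial)
        with Suc.prems(2) show "Poly_Mapping.lookup m i < d" by (force simp: lookup_add)
      qed
    qed
    then show ?case using Suc.prems(1) fixed by (simp add: partial_eq_0_iff)
  qed
  have inj0': "f = 0" if "\<sigma> f = 0" for f
  proof (rule inj0[OF that])
    show "\<forall>m\<in>Poly_Mapping.keys f.
        Poly_Mapping.lookup m i < Suc (\<Sum>q\<in>Poly_Mapping.keys f. Poly_Mapping.lookup q i)"
      by (auto simp: less_Suc_eq_le intro!: member_le_sum)
  qed
  have "inj \<sigma>"
  proof (rule injI)
    fix f g assume "\<sigma> f = \<sigma> g"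
    then show "f = g" using inj0'[of "f - g"] by (simp add: hom_diff[OF h])
  qed
  moreover have "surj \<sigma>"
    unfolding surj_def
  proof
    fix b
    obtain a n where a: "\<And>i. D (a i) = 0" and b: "b = (\<Sum>i<n. a i * s ^ i)"
      using slice_expansion_exists[OF D] by metis
    have "\<sigma> (a j) = a j" for j using a[of j] fixed ker by blast
    then have "\<sigma> (\<Sum>j<n. a j * Var i ^ j) = b"
      by (simp add: b hom_sum[OF h] hom_mult[OF h] hom_power[OF h] V)
    then show "\<exists>f. b = \<sigma> f" by metis
  qed
  ultimately show "k_algebra_aut \<sigma>" using h by (simp add: k_algebra_aut_iff bij_def)
  show "\<sigma> (Var i) = s" by (simp add: V)
qed

lemma swap_variables:
  fixes i l :: "'n::finite"
  obtains \<tau> :: "('n, 'k::field) mpoly \<Rightarrow> ('n, 'k) mpoly" where "k_algebra_aut \<tau>"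
    "\<And>f. partial l (\<tau> f) = \<tau> (partial i f)" "\<tau> (Var i) = Var l"
proof
  define \<tau> :: "('n, 'k) mpoly \<Rightarrow> ('n, 'k) mpoly"
    where "\<tau> = subst (\<lambda>j. Var (if j = i then l else if j = l then i else j))"
  have h: "k_algebra_hom \<tau>" unfolding \<tau>_def by (rule subst_hom)
  have V: "\<tau> (Var j) = Var (if j = i then l else if j = l then i else j)" for j
    by (simp add: \<tau>_def)
  have "\<tau> \<circ> \<tau> = id"
    by (rule hom_ext) (use h in \<open>auto simp: k_algebra_hom_def V\<close>)
  then have "bij \<tau>" by (rule o_bij) fact
  with h show "k_algebra_aut \<tau>" by (simp add: k_algebra_aut_iff)
  show "\<tau> (Var i) = Var l" by (simp add: V)
  show "partial l (\<tau> f) = \<tau> (partial i f)" for f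
    by (rule derivation_transport_ext[OF partial_derivation partial_derivation h])
      (auto simp: V partial_Var hom_one[OF h] hom_zero[OF h])
qed

lemma conj_eqI:
  assumes "k_algebra_aut \<phi>" "\<And>f. \<phi> (D f) = E (\<phi> f)"
  shows "\<phi> \<circ> D \<circ> inv \<phi> = E"
  using assms by (auto simp: k_algebra_aut_def fun_eq_iff bij_is_surj surj_f_inv_f)

lemma conj_eqD:
  assumes "k_algebra_aut \<phi>" "\<phi> \<circ> D \<circ> inv \<phi> = E"
  shows "\<phi> (D f) = E (\<phi> f)"
  using assms by (auto simp: k_algebra_aut_def bij_is_inj)

lemma normal_form_from_kernel:
  fixes D :: "('n::finite, 'k::field_char_0) mpoly \<Rightarrow> ('n, 'k) mpoly"
  assumes D: "k_derivation D" "locally_nilpotent D" "D s = 1"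
    and \<phi>: "k_algebra_aut \<phi>"
    and ker: "\<And>f. (\<phi> \<circ> D \<circ> inv \<phi>) f = 0 \<longleftrightarrow> f \<in> polys_without i"
  shows "\<exists>\<psi>. k_algebra_aut \<psi> \<and> \<psi> \<circ> D \<circ> inv \<psi> = partial l \<and> \<psi> s = Var l"
proof -
  let ?E = "\<phi> \<circ> D \<circ> inv \<phi>"
  have h: "k_algebra_hom \<phi>" and b: "bij \<phi>" using \<phi> by (auto simp: k_algebra_aut_iff)
  have slice: "?E (\<phi> s) = 1" using b D(3) by (simp add: bij_is_inj hom_one[OF h])
  obtain \<sigma> where \<sigma>: "k_algebra_aut \<sigma>" "\<And>f. ?E (\<sigma> f) = \<sigma> (partial i f)" "\<sigma> (Var i) = \<phi> s"
    using slice_straightening[OF conj_derivation[OF D(1) \<phi>] conj_locally_nilpotent[OF D(2) \<phi>]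
        slice ker] by metis
  obtain \<tau> :: "('n, 'k) mpoly \<Rightarrow> ('n, 'k) mpoly" where \<tau>: "k_algebra_aut \<tau>"
    "\<And>f. partial l (\<tau> f) = \<tau> (partial i f)" "\<tau> (Var i) = Var l"
    using swap_variables by metis
  have inj: "inj \<sigma>" and surj: "surj \<sigma>" using \<sigma>(1) by (auto simp: k_algebra_aut_def bij_def)
  have pull: "inv \<sigma> (?E f) = partial i (inv \<sigma> f)" for f
    using \<sigma>(2)[of "inv \<sigma> f"] by (simp only: surj_f_inv_f[OF surj] inv_f_f[OF inj])
  define \<psi> where "\<psi> = \<tau> \<circ> (inv \<sigma> \<circ> \<phi>)"
  have aut: "k_algebra_aut \<psi>"
    unfolding \<psi>_def by (intro k_algebra_aut_comp k_algebra_aut_inv \<tau>(1) \<sigma>(1) \<phi>)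
  have "\<psi> (D f) = partial l (\<psi> f)" for f
    using pull[of "\<phi> f"] b by (simp add: \<psi>_def \<tau>(2) bij_is_inj)
  then have "\<psi> \<circ> D \<circ> inv \<psi> = partial l" by (rule conj_eqI[OF aut])
  moreover have "\<psi> s = Var l"
    using \<sigma>(3)[symmetric] by (simp add: \<psi>_def inv_f_f[OF inj] \<tau>(3))
  ultimately show ?thesis using aut by blast
qed

section \<open>Diagonal derivations coming from a slice\<close>

text \<open>At the origin \<open>s\<close> vanishes, so differentiating \<open>c s D(x\<^sub>j) = w\<^sub>j x\<^sub>j\<close> gives there
  \<open>c (\<partial>s/\<partial>x\<^sub>i) D(x\<^sub>j) = w\<^sub>j \<delta>\<^sub>i\<^sub>j\<close>: a matrix of rank at most one equals the diagonal matrix of the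
  weights, so at most one weight is nonzero. They are not all zero, as \<open>s \<noteq> 0\<close>.\<close>

lemma diagonal_slice_unique_weight:
  fixes D :: "('n::finite, 'k::field_char_0) mpoly \<Rightarrow> ('n, 'k) mpoly"
  assumes D: "k_derivation D" "D s = 1" and "c \<noteq> 0"
    and diag: "\<And>f. Const c * (s * D f) = diagonal_derivation w f"
  obtains i where "w i \<noteq> 0" "\<And>j. j \<noteq> i \<Longrightarrow> w j = 0"
proof -
  have s0: "Poly_Mapping.lookup s 0 = 0"
    using arg_cong[OF diag[of s], of "\<lambda>f. Poly_Mapping.lookup f 0"] \<open>c \<noteq> 0\<close> D(2)
    by (simp add: lookup_diagonal)
  \<comment> \<open>Evaluation at the origin is the coefficient at the zero exponent.\<close>
  have lin: "w j * (if i = j then 1 else 0)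
      = c * (Poly_Mapping.lookup (partial i s) 0 * Poly_Mapping.lookup (D (Var j)) 0)" for i j
  proof -
    have "partial i (Const c * (s * D (Var j))) = partial i (Const (w j) * Var j)"
      by (simp add: diag diagonal_Var)
    then have "Const c * (s * partial i (D (Var j)) + D (Var j) * partial i s)
        = Const (w j) * partial i (Var j)"
      by (simp add: partial_mult)
    from arg_cong[OF this, of "\<lambda>f. Poly_Mapping.lookup f 0"] show ?thesis
      by (auto simp: lookup_mult_0 lookup_add s0 partial_Var mult_ac Const_def)
  qed
  have "\<exists>i. w i \<noteq> 0"
  proof (rule ccontr)
    assume "\<nexists>i. w i \<noteq> 0"
    then have "Const c * s = Const c * 0" using diag[of s] D(2) by (simp add: diagonal_derivation_def)
    then have "s = 0" using \<open>c \<noteq> 0\<close> Const_mult_cancel by blast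
    with D show False by (simp add: der_zero)
  qed
  then obtain i where i: "w i \<noteq> 0" by blast
  have "w j = 0" if "j \<noteq> i" for j
    using lin[of i i] lin[of j i] lin[of j j] i that by auto
  with i that show thesis by blast
qed

lemma linearizable_imp_normal_form:
  fixes D :: "('n::finite, 'k::field_char_0) mpoly \<Rightarrow> ('n, 'k) mpoly"
  assumes D: "k_derivation D" "locally_nilpotent D" "D s = 1" and "N \<noteq> 0"
    and "linearizable (slice_action D s N)"
  shows "\<exists>\<psi>. k_algebra_aut \<psi> \<and> \<psi> \<circ> D \<circ> inv \<psi> = partial l \<and> \<psi> s = Var l"
proof -
  obtain \<phi> w where \<phi>: "k_algebra_aut \<phi>"
    and diag: "\<phi> \<circ> (\<lambda>b. Const (of_int N) * (s * D b)) \<circ> inv \<phi> = diagonal_derivation w"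
    using assms(5) associated_derivation_unique[OF slice_action_associated[OF D \<open>N \<noteq> 0\<close>]]
    unfolding linearizable_def by metis
  let ?E = "\<phi> \<circ> D \<circ> inv \<phi>" and ?c = "of_int N :: 'k"
  have h: "k_algebra_hom \<phi>" and b: "bij \<phi>" using \<phi> by (auto simp: k_algebra_aut_iff)
  note E = conj_derivation[OF D(1) \<phi>] conj_locally_nilpotent[OF D(2) \<phi>]
  have slice: "?E (\<phi> s) = 1" using b D(3) by (simp add: bij_is_inj hom_one[OF h])
  have c: "?c \<noteq> 0" using \<open>N \<noteq> 0\<close> by simp
  have diag': "Const ?c * (\<phi> s * ?E f) = diagonal_derivation w f" for f
    unfolding diag[symmetric] by (simp add: hom_mult[OF h] hom_Const[OF h])
  obtain i where i: "w i \<noteq> 0" "\<And>j. j \<noteq> i \<Longrightarrow> w j = 0"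
    using diagonal_slice_unique_weight[OF E(1) slice c diag'] by metis
  \<comment> \<open>The factor \<open>\<phi> s\<close> can be dropped because a slice is not a zero divisor.\<close>
  have "?E f = 0 \<longleftrightarrow> f \<in> polys_without i" for f
  proof -
    have "?E f = 0 \<longleftrightarrow> Const ?c * (\<phi> s * ?E f) = 0"
      using slice_cancel[OF E slice, of "?E f"] Const_mult_cancel[OF c, of "\<phi> s * ?E f" 0] by auto
    also have "\<dots> \<longleftrightarrow> (\<forall>m. Poly_Mapping.lookup (Const (w i) * (Var i * partial i f)) m = 0)"
      unfolding diag' by (simp add: diagonal_single_weight[OF i(2)] mult.assoc poly_mapping_eq_iff fun_eq_iff)
    also have "\<dots> \<longleftrightarrow> f \<in> polys_without i"
      unfolding lookup_Const_mult lookup_Var_mult_partial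
      using i(1) by (auto simp: polys_without_def in_keys_iff)
    finally show ?thesis .
  qed
  then show ?thesis by (rule normal_form_from_kernel[OF D \<phi>])
qed

lemma normal_form_imp_linearizable:
  fixes D :: "('n::finite, 'k::field_char_0) mpoly \<Rightarrow> ('n, 'k) mpoly"
  assumes D: "k_derivation D" "locally_nilpotent D" "D s = 1" and "N \<noteq> 0"
    and \<phi>: "k_algebra_aut \<phi>" and "\<phi> \<circ> D \<circ> inv \<phi> = partial l" and "\<phi> s = Var l"
  shows "linearizable (slice_action D s N)"
proof -
  have h: "k_algebra_hom \<phi>" using \<phi> by (simp add: k_algebra_aut_iff)
  define w where "w j = (if j = l then of_int N else 0 :: 'k)" for j
  have "diagonal_derivation w f = Const (of_int N) * (Var l * partial l f)" for f
    by (subst diagonal_single_weight[of l]) (simp_all add: w_def mult.assoc)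
  then have "\<phi> \<circ> (\<lambda>b. Const (of_int N) * (s * D b)) \<circ> inv \<phi> = diagonal_derivation w"
    using assms(7) conj_eqD[OF \<phi> assms(6)]
    by (intro conj_eqI[OF \<phi>]) (simp add: hom_mult[OF h] hom_Const[OF h])
  then show ?thesis
    unfolding linearizable_def using slice_action_associated[OF D \<open>N \<noteq> 0\<close>] \<phi> by blast
qed

theorem mainTheorem1:
  fixes D :: "('n::finite, 'k::{alg_closed_field, field_char_0}) mpoly \<Rightarrow> ('n, 'k) mpoly"
    and s :: "('n, 'k) mpoly"
    and N :: int
    and l :: 'n
  assumes "k_derivation D"
    and "locally_nilpotent D"
    and "D s = 1"
    and "N \<noteq> 0"
  shows "(linearizable (slice_action D s N) \<longleftrightarrow>
           (\<exists>\<phi>. k_algebra_aut \<phi> \<and> \<phi> \<circ> D \<circ> inv \<phi> = partial l \<and> \<phi> s = Var l))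
       \<and> ((\<exists>\<phi>. k_algebra_aut \<phi> \<and> \<phi> \<circ> D \<circ> inv \<phi> = partial l \<and> \<phi> s = Var l) \<longleftrightarrow>
           (\<exists>\<phi> p. k_algebra_aut \<phi> \<and> p \<in> polys_without l \<and>
              \<phi> \<circ> D \<circ> inv \<phi> = partial l \<and> \<phi> s = Var l + p))"
proof (intro conjI iffI)
  note D = assms(1-3)
  show "\<exists>\<phi>. k_algebra_aut \<phi> \<and> \<phi> \<circ> D \<circ> inv \<phi> = partial l \<and> \<phi> s = Var l"
    if "linearizable (slice_action D s N)"
    using linearizable_imp_normal_form[OF assms that] .
  show "linearizable (slice_action D s N)"
    if "\<exists>\<phi>. k_algebra_aut \<phi> \<and> \<phi> \<circ> D \<circ> inv \<phi> = partial l \<and> \<phi> s = Var l"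
    using that normal_form_imp_linearizable[OF assms] by blast
  show "\<exists>\<phi> p. k_algebra_aut \<phi> \<and> p \<in> polys_without l \<and>
      \<phi> \<circ> D \<circ> inv \<phi> = partial l \<and> \<phi> s = Var l + p"
    if "\<exists>\<phi>. k_algebra_aut \<phi> \<and> \<phi> \<circ> D \<circ> inv \<phi> = partial l \<and> \<phi> s = Var l"
  proof -
    have "0 \<in> polys_without l" by (simp add: polys_without_def)
    with that show ?thesis by (metis add.right_neutral)
  qed
  show "\<exists>\<phi>. k_algebra_aut \<phi> \<and> \<phi> \<circ> D \<circ> inv \<phi> = partial l \<and> \<phi> s = Var l"
    if "\<exists>\<phi> p. k_algebra_aut \<phi> \<and> p \<in> polys_without l \<and>
      \<phi> \<circ> D \<circ> inv \<phi> = partial l \<and> \<phi> s = Var l + p"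
  proof -
    from that obtain \<phi> where \<phi>: "k_algebra_aut \<phi>" and eq: "\<phi> \<circ> D \<circ> inv \<phi> = partial l"
      by blast
    show ?thesis
      by (rule normal_form_from_kernel[OF D \<phi>]) (simp only: eq partial_eq_0_iff)
  qed
qed

end
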